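(* Let $R=\mathsf{k}[x_1,\dots,x_r]$ with the standard grading, and fix $\ell\in R_1$. Let $W$ be a parameter variety with a point $w_0\in W$ lying in the closure of $W\setminus\{w_0\}$, and let $A(w)$, $w\in W$, be an algebraic family of graded Artinian algebras in $G_T$ such that for $w\ne w_0$ the algebras $A(w)$ have constant Jordan type $P_\ell$ and constant Jordan degree type $\mathcal{S}_{\ell,A(w)}=\mathcal{S}_\ell$. Assume that the limit algebra $A(w_0)$ has the same Jordan type $P_\ell$. Then $$\mathcal{S}_\ell\ \ge\ \mathcal{S}_{\ell,A(w_0)} .$$
   Context: $\mathsf{k}$ is an infinite field. For a finite sequence $T=(t_0,t_1,\dots,t_j)$, $G_T$ is the scheme parametrizing the graded quotients $A=R/I$ of $R$ with Hilbert function $\dim A_i=t_i$ (for $0\le i\le j$, and $A_i=0$ for $i>j$), a closed subscheme of a product over $i$ of Grassmannians of codimension-$t_i$ subspaces $I_i$ of $R_i$. An algebraic family $A(w)$, $w\in W$, in $G_T$ is given by a morphism $W\to G_T$. Jordan type: $P_{\ell,A}$ is the partition of $\dim A$ given by the Jordan block sizes of the multiplication $m_\ell\colon A\to A$. Jordan degree type: $A$ is a direct sum of cyclic $\mathsf{k}[\ell]$-modules spanned by strings $S_k=\{z_k,\ell z_k,\dots,\ell^{p_k-1}z_k\}$ with $z_k$ homogeneous of degree $\nu_k$ and $\ell^{p_k}z_k=0$, where $P_{\ell,A}=(p_1\ge\dots\ge p_s)$. The Jordan degree type is the multiset of pairs $\mathcal{S}_{\ell,A}=((p_1,\nu_1),\dots,(p_s,\nu_s))$;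 it does not depend on the choice of strings. Truncation: $\mathcal{S}_{\ell,A,\le k}$ is obtained from $\mathcal{S}_{\ell,A}$ by replacing each pair $(p_i,\nu_i)$ by $(\min\{p_i,k+1-\nu_i\},\nu_i)$, omitting it if $\nu_i\ge k+1$. The partition associated to a collection of pairs is the collection of first entries, in non-increasing order. Order: for two algebras $A,B\in G_T$ with the same Jordan type $P_{\ell,A}=P_{\ell,B}$, $\mathcal{S}_{\ell,A}\ge\mathcal{S}_{\ell,B}$ means that for every $k$ the partition associated to $\mathcal{S}_{\ell,A,\le k}$ is greater than or equal to the partition associated to $\mathcal{S}_{\ell,B,\le k}$ in the dominance order ($P\le P'$ iff $\sum_{u=1}^ip_u\le\sum_{u=1}^ip'_u$ for all $i$). *)

theory Defs
  imports
    "HOL-Analysis.Abstract_Topology"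
    "HOL-Library.Poly_Mapping"
    "HOL-Library.Multiset"
    "Jordan_Normal_Form.Jordan_Normal_Form"
begin

section \<open>Polynomials, homogeneous ideals, graded quotients\<close>

text \<open>For a finite type \<open>'i\<close> the type \<open>('i, 'k) mpoly\<close> is the polynomial ring over \<open>'k\<close> in
  \<open>CARD('i)\<close> variables; an element of \<open>'i mono\<close> is the exponent vector of a monomial.\<close>

type_synonym 'i mono = "'i \<Rightarrow>\<^sub>0 nat"
type_synonym ('i, 'k) mpoly = "'i mono \<Rightarrow>\<^sub>0 'k"

definition monomial :: "'i mono \<Rightarrow> ('i, 'k::comm_ring_1) mpoly" where
  "monomial m = Poly_Mapping.single m 1"

definition scale :: "'k \<Rightarrow> ('i, 'k::comm_ring_1) mpoly \<Rightarrow> ('i, 'k) mpoly" where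
  "scale c f = Poly_Mapping.single 0 c * f"

definition mpeval :: "('i, 'k::comm_ring_1) mpoly \<Rightarrow> ('i \<Rightarrow> 'k) \<Rightarrow> 'k" where
  "mpeval f a = (\<Sum>m\<in>Poly_Mapping.keys f. Poly_Mapping.lookup f m *
      (\<Prod>i\<in>Poly_Mapping.keys m. a i ^ Poly_Mapping.lookup m i))"

definition mono_deg :: "'i mono \<Rightarrow> nat" where
  "mono_deg m = (\<Sum>i\<in>Poly_Mapping.keys m. Poly_Mapping.lookup m i)"

definition homog :: "nat \<Rightarrow> ('i, 'k::comm_ring_1) mpoly set" where
  "homog d = {f. \<forall>m\<in>Poly_Mapping.keys f. mono_deg m = d}"

definition hcomp :: "nat \<Rightarrow> ('i, 'k::comm_ring_1) mpoly \<Rightarrow> ('i, 'k) mpoly" where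
  "hcomp d f = (\<Sum>m | m \<in> Poly_Mapping.keys f \<and> mono_deg m = d.
      Poly_Mapping.single m (Poly_Mapping.lookup f m))"

text \<open>An ideal is a submodule of the ring over itself.\<close>

definition graded_ideal :: "('i, 'k::comm_ring_1) mpoly set \<Rightarrow> bool" where
  "graded_ideal I \<longleftrightarrow> module.subspace (*) I \<and> (\<forall>f\<in>I. \<forall>d. hcomp d f \<in> I)"

text \<open>The quotient algebra \<open>A = R/I\<close> is represented by \<open>I\<close>. As \<open>R\<^sub>i\<close> is finite-dimensional,
  \<open>dim A\<^sub>i = t\<close> says that \<open>I\<^sub>i = I \<inter> R\<^sub>i\<close> has codimension \<open>t\<close> in \<open>R\<^sub>i\<close>.\<close>

definition has_hilbert_function ::
    "('i::finite, 'k::field) mpoly set \<Rightarrow> (nat \<Rightarrow> nat) \<Rightarrow> bool" where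
  "has_hilbert_function I t \<longleftrightarrow>
     (\<forall>i. vector_space.dim scale (homog i :: ('i, 'k) mpoly set) =
            vector_space.dim scale (I \<inter> homog i) + t i)"

text \<open>The residue classes of \<open>e x\<close>, \<open>x \<in> X\<close>, form a basis of \<open>R/I\<close> (indexed without
  repetition): every class is a linear combination of them in exactly one way.\<close>

definition basis_mod ::
    "('i, 'k::field) mpoly set \<Rightarrow> 'x set \<Rightarrow> ('x \<Rightarrow> ('i, 'k) mpoly) \<Rightarrow> bool" where
  "basis_mod I X e \<longleftrightarrow> finite X \<and>
     (\<forall>f. \<exists>!c. (\<forall>x. x \<notin> X \<longrightarrow> c x = 0) \<and> f - (\<Sum>x\<in>X. scale (c x) (e x)) \<in> I)"

definition coord_mod ::
    "('i, 'k::field) mpoly set \<Rightarrow> 'x set \<Rightarrow> ('x \<Rightarrow> ('i, 'k) mpoly) \<Rightarrow> ('i, 'k) mpoly \<Rightarrow> 'x \<Rightarrow> 'k" where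
  "coord_mod I X e f =
     (THE c. (\<forall>x. x \<notin> X \<longrightarrow> c x = 0) \<and> f - (\<Sum>x\<in>X. scale (c x) (e x)) \<in> I)"

section \<open>Jordan type and Jordan degree type\<close>

text \<open>Partitions are multisets of positive integers. Both notions are stated as relations
  ``\<open>P\<close> is the Jordan type of \<open>R/I\<close>'' and ``\<open>S\<close> is the Jordan degree type of \<open>R/I\<close>''.\<close>

text \<open>Block sizes of a Jordan form of a matrix of multiplication by \<open>l\<close> on \<open>R/I\<close>.\<close>

definition is_jordan_type ::
    "('i, 'k::field) mpoly set \<Rightarrow> ('i, 'k) mpoly \<Rightarrow> nat multiset \<Rightarrow> bool" where
  "is_jordan_type I l P \<longleftrightarrow>
     (\<exists>n e n_as. basis_mod I {..<n} e \<and>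
        jordan_nf (Matrix.mat n n (\<lambda>(a, b). coord_mod I {..<n} e (l * e b) a)) n_as \<and>
        P = mset (map fst n_as))"

text \<open>The class of \<open>z k\<close> is the generator, homogeneous of degree \<open>\<nu> k\<close>, of the \<open>k\<close>-th string, which
  has length \<open>p k\<close>; the elements of all strings together form a basis of \<open>R/I\<close>.\<close>

definition is_jordan_degree_type ::
    "('i, 'k::field) mpoly set \<Rightarrow> ('i, 'k) mpoly \<Rightarrow> (nat \<times> nat) multiset \<Rightarrow> bool" where
  "is_jordan_degree_type I l S \<longleftrightarrow>
     (\<exists>s z p \<nu>.
        (\<forall>k<s. p k \<ge> 1 \<and> z k \<in> homog (\<nu> k) \<and> l ^ p k * z k \<in> I) \<and>
        basis_mod I {(k, a). k < s \<and> a < p k} (\<lambda>(k, a). l ^ a * z k) \<and>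
        S = mset (map (\<lambda>k. (p k, \<nu> k)) [0..<s]))"

definition jdt_truncate :: "nat \<Rightarrow> (nat \<times> nat) multiset \<Rightarrow> (nat \<times> nat) multiset" where
  "jdt_truncate k S =
     image_mset (\<lambda>(p, \<nu>). (min p (k + 1 - \<nu>), \<nu>)) (filter_mset (\<lambda>(p, \<nu>). \<not> \<nu> \<ge> k + 1) S)"

definition parts_desc :: "nat multiset \<Rightarrow> nat list" where
  "parts_desc P = rev (sorted_list_of_multiset P)"

text \<open>\<open>take\<close> stops at the end of the list, i.e. partitions are padded with zeros.\<close>

definition dominance_le :: "nat multiset \<Rightarrow> nat multiset \<Rightarrow> bool" where
  "dominance_le P P' \<longleftrightarrow>
     (\<forall>i. sum_list (take i (parts_desc P)) \<le> sum_list (take i (parts_desc P')))"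

definition jdt_ge :: "(nat \<times> nat) multiset \<Rightarrow> (nat \<times> nat) multiset \<Rightarrow> bool" where
  "jdt_ge S S' \<longleftrightarrow>
     (\<forall>k. dominance_le (image_mset fst (jdt_truncate k S')) (image_mset fst (jdt_truncate k S)))"

section \<open>Varieties and morphisms\<close>

text \<open>Varieties are taken in the sense of Serre: a Zariski topology on the set of
  (\<open>'k\<close>-rational) points and, for each open set \<open>U\<close>, the set of regular functions \<open>U \<rightarrow> 'k\<close>.
  Functions are total in HOL; membership in \<open>regular X U\<close> only depends on the values on \<open>U\<close>.\<close>

record ('x, 'k) fspace =
  ztop :: "'x topology"
  regular :: "'x set \<Rightarrow> ('x \<Rightarrow> 'k) set"

definition points :: "('x, 'k) fspace \<Rightarrow> 'x set" where
  "points X = topspace (ztop X)"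

definition open_subspace :: "('x, 'k) fspace \<Rightarrow> 'x set \<Rightarrow> ('x, 'k) fspace" where
  "open_subspace X U = \<lparr>ztop = subtopology (ztop X) U, regular = regular X\<rparr>"

definition morphism :: "('x, 'k) fspace \<Rightarrow> ('y, 'k) fspace \<Rightarrow> ('x \<Rightarrow> 'y) \<Rightarrow> bool" where
  "morphism X Y \<phi> \<longleftrightarrow> continuous_map (ztop X) (ztop Y) \<phi> \<and>
     (\<forall>V h. openin (ztop Y) V \<and> h \<in> regular Y V \<longrightarrow>
        (\<lambda>x. h (\<phi> x)) \<in> regular X {x \<in> points X. \<phi> x \<in> V})"

definition isomorphic :: "('x, 'k) fspace \<Rightarrow> ('y, 'k) fspace \<Rightarrow> bool" where
  "isomorphic X Y \<longleftrightarrow> (\<exists>\<phi> \<psi>. morphism X Y \<phi> \<and> morphism Y X \<psi> \<and>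
     (\<forall>x\<in>points X. \<psi> (\<phi> x) = x) \<and> (\<forall>y\<in>points Y. \<phi> (\<psi> y) = y))"

text \<open>The space glued from charts \<open>(U, c)\<close>, where \<open>c\<close> is the tuple of coordinate functions on \<open>U\<close>:
  the topology is generated by the principal open subsets of the charts, and a function is regular
  if locally, in some chart, it is a quotient of polynomials in the coordinates.\<close>

definition principal_open ::
    "'x set \<Rightarrow> ('x \<Rightarrow> 'i \<Rightarrow> 'k::field) \<Rightarrow> ('i, 'k) mpoly \<Rightarrow> 'x set" where
  "principal_open U c g = {x \<in> U. mpeval g (c x) \<noteq> 0}"

definition charted_space :: "('x set \<times> ('x \<Rightarrow> 'i \<Rightarrow> 'k::field)) set \<Rightarrow> ('x, 'k) fspace" where
  "charted_space \<C> =
     (let \<T> = topology_generated_by {principal_open U c g | U c g. (U, c) \<in> \<C>} in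
      \<lparr>ztop = \<T>,
       regular = (\<lambda>V. {h. \<forall>x\<in>V. \<exists>(U, c)\<in>\<C>. \<exists>f g N.
          openin \<T> N \<and> x \<in> N \<and> N \<subseteq> V \<inter> U \<and>
          (\<forall>y\<in>N. mpeval g (c y) \<noteq> 0 \<and> h y = mpeval f (c y) / mpeval g (c y))})\<rparr>)"

text \<open>The zero set in \<open>'k\<^sup>n\<close> of a set of polynomials; points of \<open>'k\<^sup>n\<close> are the sequences that
  vanish from index \<open>n\<close> on.\<close>

definition affine_set :: "nat \<Rightarrow> (nat, 'k::field) mpoly set \<Rightarrow> (nat \<Rightarrow> 'k) set" where
  "affine_set n F = {a. (\<forall>i\<ge>n. a i = 0) \<and> (\<forall>f\<in>F. mpeval f a = 0)}"

definition affine_variety :: "nat \<Rightarrow> (nat, 'k::field) mpoly set \<Rightarrow> (nat \<Rightarrow> 'k, 'k) fspace" where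
  "affine_variety n F = charted_space {(affine_set n F, \<lambda>a. a)}"

definition function_sheaf :: "('x, 'k) fspace \<Rightarrow> bool" where
  "function_sheaf X \<longleftrightarrow>
     (\<forall>U V h. openin (ztop X) U \<and> openin (ztop X) V \<and> V \<subseteq> U \<and> h \<in> regular X U \<longrightarrow> h \<in> regular X V) \<and>
     (\<forall>U h. openin (ztop X) U \<and>
        (\<forall>x\<in>U. \<exists>V. openin (ztop X) V \<and> x \<in> V \<and> V \<subseteq> U \<and> h \<in> regular X V) \<longrightarrow> h \<in> regular X U) \<and>
     (\<forall>U h h'. openin (ztop X) U \<and> h \<in> regular X U \<and> (\<forall>x\<in>U. h' x = h x) \<longrightarrow> h' \<in> regular X U)"

text \<open>Neither irreducibility nor separatedness is required.\<close>

definition variety :: "('x, 'k::field) fspace \<Rightarrow> bool" where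
  "variety X \<longleftrightarrow> function_sheaf X \<and>
     (\<exists>\<U>. finite \<U> \<and> \<Union>\<U> = points X \<and>
        (\<forall>U\<in>\<U>. openin (ztop X) U \<and>
           (\<exists>n F. isomorphic (open_subspace X U) (affine_variety n F))))"

section \<open>The parameter space of graded quotients with Hilbert function \<open>T\<close>\<close>

text \<open>\<open>T = (t\<^sub>0, \<dots>, t\<^sub>j)\<close> is given by \<open>j\<close> and the values \<open>t i\<close> for \<open>i \<le> j\<close>.\<close>

definition GT_points :: "nat \<Rightarrow> (nat \<Rightarrow> nat) \<Rightarrow> ('i::finite, 'k::field) mpoly set set" where
  "GT_points j t =
     {I. graded_ideal I \<and> has_hilbert_function I (\<lambda>i. if i \<le> j then t i else 0)}"

text \<open>The structure induced from the product of the Grassmannians of the \<open>R\<^sub>i\<close>, described by the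
  standard affine charts: for a finite set \<open>B\<close> of monomials, the chart consists of the \<open>I\<close> such that
  for every \<open>i\<close> the span of the monomials of degree \<open>i\<close> in \<open>B\<close> is a complement of \<open>I\<^sub>i\<close>, i.e.\ such
  that \<open>B\<close> is a basis of \<open>R/I\<close>. The coordinates of \<open>I\<close> are the entries of the matrix writing each
  monomial \<open>m\<close> modulo \<open>I\<close> in terms of \<open>B\<close> (those with \<open>m\<close> of degree \<open>> j\<close>, or \<open>m\<close> and \<open>b\<close> of different
  degrees, are identically zero). These charts cover: every \<open>R/I\<close> has a basis of monomials.\<close>

definition GT_chart ::
    "nat \<Rightarrow> (nat \<Rightarrow> nat) \<Rightarrow> 'i mono set \<Rightarrow> ('i::finite, 'k::field) mpoly set set" where
  "GT_chart j t B = {I \<in> GT_points j t. basis_mod I B monomial}"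

definition GT_coord ::
    "'i mono set \<Rightarrow> ('i::finite, 'k::field) mpoly set \<Rightarrow> 'i mono \<times> 'i mono \<Rightarrow> 'k" where
  "GT_coord B I = (\<lambda>(m, b). coord_mod I B monomial (monomial m) b)"

definition GT :: "nat \<Rightarrow> (nat \<Rightarrow> nat) \<Rightarrow> (('i::finite, 'k::field) mpoly set, 'k) fspace" where
  "GT j t = charted_space {(GT_chart j t B, GT_coord B) | B. finite B}"

end

theory Submission
  imports Defs
begin

text \<open>
  The sum of the first \<open>i\<close> parts of a partition is the minimum over \<open>a\<close> of
  \<open>i * a + (\<Sum>q. max 0 (q - a))\<close>. Dominance of partitions therefore follows from the inequalities
  between the numbers \<open>\<Sum>q. max 0 (q - a)\<close>, one for each \<open>a\<close> (\<open>dominance_leI\<close>). For the truncation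
  in degree \<open>k\<close> of a Jordan degree type this number counts the string elements \<open>l ^ b * z\<close> of
  degree at most \<open>k\<close> with \<open>b \<ge> a\<close> (\<open>sum_truncated_parts\<close>); it is the rank of multiplication by
  \<open>l ^ a\<close> on the quotient \<open>A / A\<^sub>>\<^sub>k\<close>. The statement thus expresses that these ranks can only drop in
  the limit.

  To compare the ranks, the strings of the limit algebra \<open>A w0\<close> are kept fixed as a family of
  polynomials while the ideal moves. In a chart around \<open>A w0\<close> given by a monomial basis \<open>B\<close>, the
  determinant of the coordinates of this family with respect to \<open>B\<close> is a polynomial in the chart
  coordinates, and it does not vanish at \<open>A w0\<close>. So the family stays linearly independent on an open
  neighbourhood (\<open>basis_mod_open_independent\<close>), and this neighbourhood contains some \<open>A w\<close> with
  \<open>w \<noteq> w0\<close>. There each \<open>l ^ b * z\<close> with \<open>b \<ge> a\<close> is \<open>l ^ a\<close> times a homogeneous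
  element; expanding the latter in the strings of \<open>A w\<close> shows that \<open>l ^ b * z\<close> lies in the span of
  the elements counted for \<open>S\<close>, which bounds the number of elements counted for \<open>S0\<close>
  (\<open>string_part_card_le\<close>).
\<close>

section \<open>Evaluation, homogeneity and homogeneous components\<close>

lemma lookup_scale: "Poly_Mapping.lookup (scale c f) m = c * Poly_Mapping.lookup f m"
  unfolding scale_def
  by (simp add: mult_map_scale_conv_mult[symmetric] Poly_Mapping.map.rep_eq when_def)

lemma scale_mult_right: "f * scale c g = scale c (f * g)"
  by (simp add: scale_def ac_simps)

lemma scale_zero [simp]: "scale 0 f = 0"
  by (rule poly_mapping_eqI) (simp add: lookup_scale)

lemma scale_scale: "scale c (scale d f) = scale (c * d) f"
  by (rule poly_mapping_eqI) (simp add: lookup_scale ac_simps)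

lemma scale_sum_left: "scale (\<Sum>x\<in>X. c x) f = (\<Sum>x\<in>X. scale (c x) f)"
  by (rule poly_mapping_eqI) (simp add: lookup_scale lookup_sum sum_distrib_right)

lemma scale_sum_right: "scale c (\<Sum>x\<in>X. f x) = (\<Sum>x\<in>X. scale c (f x))"
  by (simp add: scale_def sum_distrib_left)

lemma scale_diff_right: "scale c (f - g) = scale c f - scale c g"
  by (simp add: scale_def right_diff_distrib)

lemma sum_single_keys:
  "(\<Sum>m\<in>Poly_Mapping.keys f. Poly_Mapping.single m (Poly_Mapping.lookup f m)) = f"
  by (rule poly_mapping_eqI)
    (auto simp: lookup_sum lookup_single when_def in_keys_iff)

lemma sum_scale_monomial:
  "(\<Sum>m\<in>Poly_Mapping.keys f. scale (Poly_Mapping.lookup f m) (monomial m)) = f"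
  by (subst (3) sum_single_keys[symmetric]) (simp add: scale_def monomial_def mult_single)

lemma mpeval_superset:
  assumes "finite M" "Poly_Mapping.keys f \<subseteq> M"
  shows "mpeval f a = (\<Sum>m\<in>M. Poly_Mapping.lookup f m *
      (\<Prod>i\<in>Poly_Mapping.keys m. a i ^ Poly_Mapping.lookup m i))"
  unfolding mpeval_def using assms
  by (intro sum.mono_neutral_left) (auto simp: in_keys_iff)

lemma mpeval_add: "mpeval (f + g) a = mpeval f a + mpeval g a"
proof -
  let ?M = "Poly_Mapping.keys f \<union> Poly_Mapping.keys g"
  have "Poly_Mapping.keys (f + g) \<subseteq> ?M" by (rule keys_add)
  then show ?thesis
    by (simp add: mpeval_superset[where M = ?M] lookup_add distrib_right sum.distrib)
qed

lemma mpeval_0 [simp]: "mpeval 0 a = 0"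
  by (simp add: mpeval_def)

lemma mpeval_sum: "mpeval (\<Sum>x\<in>X. f x) a = (\<Sum>x\<in>X. mpeval (f x) a)"
  by (induction X rule: infinite_finite_induct) (simp_all add: mpeval_add)

lemma mpeval_single:
  "mpeval (Poly_Mapping.single m c) a =
     c * (\<Prod>i\<in>Poly_Mapping.keys m. a i ^ Poly_Mapping.lookup m i)"
  by (subst mpeval_superset[where M = "{m}"]) auto

lemma monomial_value_add:
  fixes m n :: "'i mono" and a :: "'i \<Rightarrow> 'k::comm_ring_1"
  shows "(\<Prod>i\<in>Poly_Mapping.keys (m + n). a i ^ Poly_Mapping.lookup (m + n) i) =
    (\<Prod>i\<in>Poly_Mapping.keys m. a i ^ Poly_Mapping.lookup m i) *
    (\<Prod>i\<in>Poly_Mapping.keys n. a i ^ Poly_Mapping.lookup n i)"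
proof -
  let ?M = "Poly_Mapping.keys m \<union> Poly_Mapping.keys n"
  have extend: "(\<Prod>i\<in>Poly_Mapping.keys x. a i ^ Poly_Mapping.lookup x i) =
      (\<Prod>i\<in>?M. a i ^ Poly_Mapping.lookup x i)" if "Poly_Mapping.keys x \<subseteq> ?M" for x
    using that by (intro prod.mono_neutral_left) (auto simp: in_keys_iff)
  show ?thesis
    unfolding extend[OF keys_add] extend[OF Un_upper1] extend[OF Un_upper2]
    by (simp add: lookup_add power_add prod.distrib)
qed

lemma mpeval_mult: "mpeval (f * g) a = mpeval f a * mpeval g a"
proof -
  have "f * g = (\<Sum>m\<in>Poly_Mapping.keys f. \<Sum>n\<in>Poly_Mapping.keys g.
      Poly_Mapping.single (m + n) (Poly_Mapping.lookup f m * Poly_Mapping.lookup g n))"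
    by (subst sum_single_keys[of f, symmetric], subst sum_single_keys[of g, symmetric])
      (simp add: sum_product mult_single)
  then show ?thesis
    by (simp add: mpeval_sum mpeval_single monomial_value_add mpeval_def[of f] mpeval_def[of g]
        sum_product ac_simps)
qed

lemma mono_deg_add: "mono_deg (m + n) = mono_deg m + mono_deg n"
proof -
  let ?M = "Poly_Mapping.keys m \<union> Poly_Mapping.keys n"
  have extend: "mono_deg x = (\<Sum>i\<in>?M. Poly_Mapping.lookup x i)"
    if "Poly_Mapping.keys x \<subseteq> ?M" for x
    unfolding mono_deg_def using that
    by (intro sum.mono_neutral_left) (auto simp: in_keys_iff)
  show ?thesis
    unfolding extend[OF keys_add] extend[OF Un_upper1] extend[OF Un_upper2]
    by (simp add: lookup_add sum.distrib)
qed

lemma homog_mult: "f \<in> homog d \<Longrightarrow> g \<in> homog e \<Longrightarrow> f * g \<in> homog (d + e)"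
  unfolding homog_def using keys_mult[of f g] by (auto simp: mono_deg_add)

lemma homog_power:
  assumes "f \<in> homog d"
  shows "f ^ n \<in> homog (n * d)"
proof (induction n)
  case 0
  show ?case
    by (auto simp: homog_def mono_deg_def simp flip: single_one split: if_splits)
next
  case (Suc n)
  then show ?case using homog_mult[OF assms Suc] by simp
qed

lemma lookup_hcomp:
  "Poly_Mapping.lookup (hcomp d f) m = (if mono_deg m = d then Poly_Mapping.lookup f m else 0)"
  by (auto simp: hcomp_def lookup_sum lookup_single when_def in_keys_iff)

lemma hcomp_homog: "f \<in> homog e \<Longrightarrow> hcomp d f = (if e = d then f else 0)"
  by (rule poly_mapping_eqI) (auto simp: lookup_hcomp homog_def in_keys_iff)

lemma hcomp_diff: "hcomp d (f - g) = hcomp d f - hcomp d g"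
  by (rule poly_mapping_eqI) (simp add: lookup_hcomp lookup_minus)

lemma hcomp_sum: "hcomp d (\<Sum>x\<in>X. f x) = (\<Sum>x\<in>X. hcomp d (f x))"
  by (rule poly_mapping_eqI) (simp add: lookup_hcomp lookup_sum)

lemma hcomp_scale: "hcomp d (scale c f) = scale c (hcomp d f)"
  by (rule poly_mapping_eqI) (simp add: lookup_hcomp lookup_scale)

section \<open>Linear algebra modulo an ideal\<close>

abbreviation is_ideal :: "('i, 'k::comm_ring_1) mpoly set \<Rightarrow> bool" where
  "is_ideal \<equiv> module.subspace (*)"

lemma ideal_iff:
  fixes I :: "('i, 'k::comm_ring_1) mpoly set"
  shows "is_ideal I \<longleftrightarrow> 0 \<in> I \<and> (\<forall>f\<in>I. \<forall>g\<in>I. f + g \<in> I) \<and> (\<forall>h. \<forall>f\<in>I. h * f \<in> I)"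
proof -
  have "Modules.module ((*) :: ('i, 'k) mpoly \<Rightarrow> _)"
    by unfold_locales (auto simp: algebra_simps)
  then show ?thesis
    by (rule Modules.module.subspace_def)
qed

lemma ideal_0: "is_ideal I \<Longrightarrow> 0 \<in> I"
  and ideal_add: "is_ideal I \<Longrightarrow> f \<in> I \<Longrightarrow> g \<in> I \<Longrightarrow> f + g \<in> I"
  and ideal_mult: "is_ideal I \<Longrightarrow> f \<in> I \<Longrightarrow> h * f \<in> I"
  by (auto simp: ideal_iff)

lemma ideal_diff: "is_ideal I \<Longrightarrow> f \<in> I \<Longrightarrow> g \<in> I \<Longrightarrow> f - g \<in> I"
  using ideal_add[of I f "- 1 * g"] ideal_mult[of I g "- 1"] by simp

lemma ideal_scale: "is_ideal I \<Longrightarrow> f \<in> I \<Longrightarrow> scale c f \<in> I"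
  unfolding scale_def by (rule ideal_mult)

lemma ideal_sum: "is_ideal I \<Longrightarrow> (\<And>x. x \<in> X \<Longrightarrow> f x \<in> I) \<Longrightarrow> (\<Sum>x\<in>X. f x) \<in> I"
  by (induction X rule: infinite_finite_induct) (auto simp: ideal_0 ideal_add)

lemma graded_ideal_ideal: "graded_ideal I \<Longrightarrow> is_ideal I"
  by (simp add: graded_ideal_def)

definition independent_mod ::
    "('i, 'k::field) mpoly set \<Rightarrow> 'x set \<Rightarrow> ('x \<Rightarrow> ('i, 'k) mpoly) \<Rightarrow> bool" where
  "independent_mod I X e \<longleftrightarrow> (\<forall>c. (\<Sum>x\<in>X. scale (c x) (e x)) \<in> I \<longrightarrow> (\<forall>x\<in>X. c x = 0))"

lemma independent_mod_subset:
  assumes "independent_mod I X e" "finite X" "Y \<subseteq> X"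
  shows "independent_mod I Y e"
  unfolding independent_mod_def
proof (intro allI impI)
  fix c assume "(\<Sum>x\<in>Y. scale (c x) (e x)) \<in> I"
  moreover have "(\<Sum>x\<in>X. scale (if x \<in> Y then c x else 0) (e x)) = (\<Sum>x\<in>Y. scale (c x) (e x))"
    using assms by (intro sum.mono_neutral_cong_right) auto
  ultimately have "\<forall>x\<in>X. (if x \<in> Y then c x else 0) = 0"
    using assms(1)[unfolded independent_mod_def, rule_format, of "\<lambda>x. if x \<in> Y then c x else 0"]
    by auto
  then show "\<forall>x\<in>Y. c x = 0"
    using assms(3) by (metis subsetD)
qed

lemma coord_mod_works:
  assumes "basis_mod I X e"
  shows "f - (\<Sum>x\<in>X. scale (coord_mod I X e f x) (e x)) \<in> I"
    and "x \<notin> X \<Longrightarrow> coord_mod I X e f x = 0"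
proof -
  let ?P = "\<lambda>c. (\<forall>x. x \<notin> X \<longrightarrow> c x = 0) \<and> f - (\<Sum>x\<in>X. scale (c x) (e x)) \<in> I"
  have "\<exists>!c. ?P c"
    using assms by (simp add: basis_mod_def)
  then have "?P (coord_mod I X e f)"
    unfolding coord_mod_def by (rule theI')
  then show "f - (\<Sum>x\<in>X. scale (coord_mod I X e f x) (e x)) \<in> I"
    and "x \<notin> X \<Longrightarrow> coord_mod I X e f x = 0"
    by auto
qed

lemma coord_mod_unique:
  assumes basis: "basis_mod I X e"
    and c: "f - (\<Sum>x\<in>X. scale (c x) (e x)) \<in> I" and x: "x \<in> X"
  shows "coord_mod I X e f x = c x"
proof -
  let ?P = "\<lambda>c. (\<forall>x. x \<notin> X \<longrightarrow> c x = 0) \<and> f - (\<Sum>x\<in>X. scale (c x) (e x)) \<in> I"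
  let ?c = "\<lambda>x. if x \<in> X then c x else 0"
  have "(\<Sum>x\<in>X. scale (?c x) (e x)) = (\<Sum>x\<in>X. scale (c x) (e x))"
    by (rule sum.cong) auto
  then have "?P ?c"
    using c by auto
  moreover have "\<exists>!c. ?P c"
    using basis by (simp add: basis_mod_def)
  ultimately have "coord_mod I X e f = ?c"
    unfolding coord_mod_def by (intro the1_equality)
  then show ?thesis
    using x by simp
qed

lemma basis_mod_independent:
  assumes "is_ideal I" "basis_mod I X e"
  shows "independent_mod I X e"
  unfolding independent_mod_def
proof (intro allI impI ballI)
  fix c x assume c: "(\<Sum>x\<in>X. scale (c x) (e x)) \<in> I" and x: "x \<in> X"
  have "coord_mod I X e 0 x = c x"
    using ideal_diff[OF assms(1) ideal_0[OF assms(1)] c] by (intro coord_mod_unique assms x)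
  moreover have "coord_mod I X e 0 x = 0"
    using ideal_0[OF assms(1)] by (intro coord_mod_unique assms x) simp
  ultimately show "c x = 0"
    by simp
qed

text \<open>Coordinates modulo an ideal are linear: combining the expansions of the \<open>f y\<close> gives an expansion
  of the combination, and expansions are unique.\<close>

lemma coord_mod_linear:
  assumes I: "is_ideal I" and basis: "basis_mod I X e" and x: "x \<in> X"
  shows "coord_mod I X e (\<Sum>y\<in>Y. scale (c y) (f y)) x = (\<Sum>y\<in>Y. c y * coord_mod I X e (f y) x)"
proof (rule coord_mod_unique[OF basis _ x])
  have "(\<Sum>y\<in>Y. scale (c y) (f y)) -
      (\<Sum>x\<in>X. scale (\<Sum>y\<in>Y. c y * coord_mod I X e (f y) x) (e x)) =
      (\<Sum>y\<in>Y. scale (c y) (f y - (\<Sum>x\<in>X. scale (coord_mod I X e (f y) x) (e x))))"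
    by (simp add: scale_sum_left scale_sum_right scale_diff_right scale_scale sum_subtractf
        sum.swap[of _ X Y])
  also have "\<dots> \<in> I"
    by (rule ideal_sum[OF I], rule ideal_scale[OF I], rule coord_mod_works(1)[OF basis])
  finally show "(\<Sum>y\<in>Y. scale (c y) (f y)) -
      (\<Sum>x\<in>X. scale (\<Sum>y\<in>Y. c y * coord_mod I X e (f y) x) (e x)) \<in> I" .
qed

lemma underdetermined_system_has_solution:
  fixes a :: "'x \<Rightarrow> 'y \<Rightarrow> 'k::field"
  assumes "finite Y" "finite X" "card Y < card X"
  shows "\<exists>c. (\<exists>x\<in>X. c x \<noteq> 0) \<and> (\<forall>y\<in>Y. (\<Sum>x\<in>X. c x * a x y) = 0)"
  using assms
proof (induction Y arbitrary: X a rule: finite_induct)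
  case empty
  then have "X \<noteq> {}"
    by auto
  then show ?case
    by (intro exI[of _ "\<lambda>_. 1"]) auto
next
  case (insert y0 Y)
  show ?case
  proof (cases "\<forall>x\<in>X. a x y0 = 0")
    case True
    obtain c where "\<exists>x\<in>X. c x \<noteq> 0" "\<forall>y\<in>Y. (\<Sum>x\<in>X. c x * a x y) = 0"
      using insert.IH[of X a] insert.prems insert.hyps by auto
    then show ?thesis
      using True by (intro exI[of _ c]) auto
  next
    case False
    then obtain x0 where x0: "x0 \<in> X" "a x0 y0 \<noteq> 0"
      by auto
    \<comment> \<open>Gaussian elimination: equation \<open>y0\<close> is solved for the unknown \<open>x0\<close>.\<close>
    define X' where "X' = X - {x0}"
    have X: "X = insert x0 X'" "x0 \<notin> X'" "finite X'"
      using x0 insert.prems by (auto simp: X'_def)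
    have "card Y < card X'"
      using insert.prems insert.hyps x0 by (simp add: X'_def)
    from insert.IH[OF X(3) this, of "\<lambda>x y. a x y - a x y0 / a x0 y0 * a x0 y"]
    obtain c where c: "\<exists>x\<in>X'. c x \<noteq> 0"
      "\<And>y. y \<in> Y \<Longrightarrow> (\<Sum>x\<in>X'. c x * (a x y - a x y0 / a x0 y0 * a x0 y)) = 0"
      by blast
    define c' where "c' = c(x0 := - (\<Sum>x\<in>X'. c x * a x y0) / a x0 y0)"
    have expand: "(\<Sum>x\<in>X. c' x * a x y) =
        - (\<Sum>x\<in>X'. c x * a x y0) / a x0 y0 * a x0 y + (\<Sum>x\<in>X'. c x * a x y)" for y
    proof -
      have "(\<Sum>x\<in>X'. c' x * a x y) = (\<Sum>x\<in>X'. c x * a x y)"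
        using X by (intro sum.cong) (auto simp: c'_def)
      then show ?thesis
        using X by (simp add: c'_def)
    qed
    have "(\<Sum>x\<in>X. c' x * a x y) = 0" if "y \<in> insert y0 Y" for y
    proof (cases "y = y0")
      case True
      then show ?thesis
        using x0 by (simp add: expand)
    next
      case False
      then have "(\<Sum>x\<in>X'. c x * (a x y - a x y0 / a x0 y0 * a x0 y)) = 0"
        using c(2) that by auto
      then have "(\<Sum>x\<in>X'. c x * a x y) = (\<Sum>x\<in>X'. c x * (a x y0 / a x0 y0 * a x0 y))"
        by (simp add: right_diff_distrib sum_subtractf)
      also have "\<dots> = (\<Sum>x\<in>X'. c x * a x y0) / a x0 y0 * a x0 y"
        by (simp add: sum_distrib_right sum_divide_distrib mult.assoc)
      finally show ?thesis
        by (simp add: expand)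
    qed
    moreover have "\<exists>x\<in>X. c' x \<noteq> 0"
    proof -
      obtain x where "x \<in> X'" "c x \<noteq> 0"
        using c(1) by blast
      then have "x \<in> X" "c' x \<noteq> 0"
        using X by (auto simp: c'_def)
      then show ?thesis
        by blast
    qed
    ultimately show ?thesis
      by (intro exI[of _ c'] conjI ballI)
  qed
qed

text \<open>The exchange bound modulo an ideal. If \<open>X\<close> had more elements than \<open>Y\<close>, the coefficients of the
  \<open>e x\<close> in terms of the \<open>f y\<close> would form an underdetermined homogeneous system, and a nontrivial
  solution of it is a linear relation between the \<open>e x\<close>.\<close>

lemma independent_mod_card_le:
  assumes I: "is_ideal I" and indep: "independent_mod I X e" and fin: "finite X" "finite Y"
    and span: "\<And>x. x \<in> X \<Longrightarrow> \<exists>a. e x - (\<Sum>y\<in>Y. scale (a y) (f y)) \<in> I"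
  shows "card X \<le> card Y"
proof (rule ccontr)
  assume "\<not> card X \<le> card Y"
  have "\<exists>a. \<forall>x\<in>X. e x - (\<Sum>y\<in>Y. scale (a x y) (f y)) \<in> I"
    by (rule bchoice) (rule ballI, rule span)
  then obtain a where a: "\<And>x. x \<in> X \<Longrightarrow> e x - (\<Sum>y\<in>Y. scale (a x y) (f y)) \<in> I"
    by blast
  have "card Y < card X"
    using \<open>\<not> card X \<le> card Y\<close> by simp
  from underdetermined_system_has_solution[OF fin(2,1) this, of a]
  obtain c where c: "\<exists>x\<in>X. c x \<noteq> 0" "\<And>y. y \<in> Y \<Longrightarrow> (\<Sum>x\<in>X. c x * a x y) = 0"
    by blast
  have "(\<Sum>x\<in>X. scale (c x) (\<Sum>y\<in>Y. scale (a x y) (f y))) =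
      (\<Sum>y\<in>Y. scale (\<Sum>x\<in>X. c x * a x y) (f y))"
    by (simp only: scale_sum_left scale_sum_right scale_scale sum.swap[of _ X Y])
  also have "\<dots> = 0"
    using c(2) by (intro sum.neutral) auto
  finally have "(\<Sum>x\<in>X. scale (c x) (e x)) =
      (\<Sum>x\<in>X. scale (c x) (e x - (\<Sum>y\<in>Y. scale (a x y) (f y))))"
    by (simp add: scale_diff_right sum_subtractf)
  also have "\<dots> \<in> I"
    by (rule ideal_sum[OF I], rule ideal_scale[OF I], rule a)
  finally show False
    using indep c(1) by (auto simp: independent_mod_def)
qed

lemma basis_mod_finite: "basis_mod I X e \<Longrightarrow> finite X"
  by (simp add: basis_mod_def)

lemma basis_mod_card_le:
  assumes "is_ideal I" "basis_mod I X e" "basis_mod I Y f"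
  shows "card X \<le> card Y"
proof (rule independent_mod_card_le[OF assms(1) basis_mod_independent[OF assms(1,2)]])
  show "\<exists>a. e x - (\<Sum>y\<in>Y. scale (a y) (f y)) \<in> I" for x
    by (rule exI, rule coord_mod_works(1)[OF assms(3)])
qed (use assms in \<open>simp_all add: basis_mod_finite\<close>)

lemma basis_mod_card_eq:
  assumes "is_ideal I" "basis_mod I X e" "basis_mod I Y f"
  shows "card X = card Y"
  using basis_mod_card_le[OF assms] basis_mod_card_le[OF assms(1,3,2)] by simp

section \<open>Linear independence is an open condition\<close>

text \<open>The kernel of the coordinate matrix consists of the linear relations modulo \<open>I\<close> of the family.
  The bijections number the basis and the family, so the matrix is square.\<close>

lemma independent_mod_iff_det_nonzero:
  assumes I: "is_ideal I" and basis: "basis_mod I B e"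
    and b: "bij_betw b {0..<n} B" and x: "bij_betw x {0..<n} X"
  shows "independent_mod I X f \<longleftrightarrow>
    det (Matrix.mat n n (\<lambda>(i, k). coord_mod I B e (f (x k)) (b i))) \<noteq> 0"
proof -
  let ?M = "Matrix.mat n n (\<lambda>(i, k). coord_mod I B e (f (x k)) (b i))"
  have M: "?M \<in> carrier_mat n n"
    by simp
  have entry: "(?M *\<^sub>v v) $ i = coord_mod I B e (\<Sum>k<n. scale (v $ k) (f (x k))) (b i)"
    if "v \<in> carrier_vec n" "i < n" for v i
  proof -
    have "b i \<in> B"
      using b that by (auto simp: bij_betw_def)
    then show ?thesis
      using that by (simp add: coord_mod_linear[OF I basis] scalar_prod_def mult.commute
          atLeast0LessThan)
  qed
  have kernel: "?M *\<^sub>v v = 0\<^sub>v n \<longleftrightarrow> (\<Sum>k<n. scale (v $ k) (f (x k))) \<in> I" (is "_ \<longleftrightarrow> ?g \<in> I")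
    if v: "v \<in> carrier_vec n" for v
  proof
    assume "?M *\<^sub>v v = 0\<^sub>v n"
    then have "coord_mod I B e ?g (b i) = 0" if "i < n" for i
      using entry[OF v that] that by simp
    then have "coord_mod I B e ?g y = 0" if "y \<in> B" for y
      using b that by (auto simp: bij_betw_def)
    then show "?g \<in> I"
      using coord_mod_works(1)[OF basis, of ?g] by simp
  next
    assume g: "?g \<in> I"
    have "coord_mod I B e ?g (b i) = 0" if "i < n" for i
      using b that g by (intro coord_mod_unique[OF basis]) (auto simp: bij_betw_def)
    then show "?M *\<^sub>v v = 0\<^sub>v n"
      using entry[OF v] by (intro eq_vecI) auto
  qed
  have reindex: "(\<Sum>k<n. scale (c (x k)) (f (x k))) = (\<Sum>y\<in>X. scale (c y) (f y))" for c
    using sum.reindex_bij_betw[OF x, of "\<lambda>y. scale (c y) (f y)"] by (simp add: atLeast0LessThan)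
  show ?thesis
  proof
    assume indep: "independent_mod I X f"
    show "det ?M \<noteq> 0"
    proof
      assume "det ?M = 0"
      then obtain v where v: "v \<in> carrier_vec n" "v \<noteq> 0\<^sub>v n" "?M *\<^sub>v v = 0\<^sub>v n"
        using det_0_iff_vec_prod_zero[OF M] by blast
      define c where "c y = v $ (the_inv_into {0..<n} x y)" for y
      have c: "c (x k) = v $ k" if "k < n" for k
        using x that by (simp add: c_def the_inv_into_f_f bij_betw_def)
      then have "(\<Sum>y\<in>X. scale (c y) (f y)) \<in> I"
        using kernel[OF v(1)] v(3) reindex[of c] by simp
      then have "v $ k = 0" if "k < n" for k
        using indep c[OF that] x that by (fastforce simp: independent_mod_def bij_betw_def)
      then show False
        using v by (metis eq_vecI carrier_vecD index_zero_vec)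
    qed
  next
    assume det: "det ?M \<noteq> 0"
    show "independent_mod I X f"
      unfolding independent_mod_def
    proof (intro allI impI ballI)
      fix c y assume c: "(\<Sum>y\<in>X. scale (c y) (f y)) \<in> I" and y: "y \<in> X"
      define v where "v = Matrix.vec n (\<lambda>k. c (x k))"
      have "(\<Sum>k<n. scale (v $ k) (f (x k))) \<in> I"
        using c reindex[of c] by (simp add: v_def)
      moreover have v: "v \<in> carrier_vec n"
        by (simp add: v_def)
      ultimately have "?M *\<^sub>v v = 0\<^sub>v n"
        using kernel by blast
      then have "v = 0\<^sub>v n"
        using v det det_0_iff_vec_prod_zero[OF M] by blast
      then have "c (x k) = 0" if "k < n" for k
        using that by (metis index_vec index_zero_vec(1) v_def)
      then show "c y = 0"
        using x y by (auto simp: bij_betw_def)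
    qed
  qed
qed

definition polynomial_on :: "'x set \<Rightarrow> ('x \<Rightarrow> 'i \<Rightarrow> 'k::field) \<Rightarrow> ('x \<Rightarrow> 'k) \<Rightarrow> bool" where
  "polynomial_on U c h \<longleftrightarrow> (\<exists>g. \<forall>x\<in>U. h x = mpeval g (c x))"

lemma polynomial_on_const: "polynomial_on U c (\<lambda>_. a)"
  unfolding polynomial_on_def
  by (intro exI[of _ "Poly_Mapping.single 0 a"]) (simp add: mpeval_single)

lemma polynomial_on_coordinate: "polynomial_on U c (\<lambda>x. c x i)"
  unfolding polynomial_on_def
  by (intro exI[of _ "Poly_Mapping.single (Poly_Mapping.single i 1) 1"]) (simp add: mpeval_single)

lemma polynomial_on_add:
  "polynomial_on U c h \<Longrightarrow> polynomial_on U c h' \<Longrightarrow> polynomial_on U c (\<lambda>x. h x + h' x)"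
  unfolding polynomial_on_def using mpeval_add by metis

lemma polynomial_on_mult:
  "polynomial_on U c h \<Longrightarrow> polynomial_on U c h' \<Longrightarrow> polynomial_on U c (\<lambda>x. h x * h' x)"
  unfolding polynomial_on_def using mpeval_mult by metis

lemma polynomial_on_sum:
  "(\<And>y. y \<in> Y \<Longrightarrow> polynomial_on U c (h y)) \<Longrightarrow> polynomial_on U c (\<lambda>x. \<Sum>y\<in>Y. h y x)"
  by (induction Y rule: infinite_finite_induct)
    (auto simp: polynomial_on_const polynomial_on_add)

lemma polynomial_on_prod:
  "(\<And>y. y \<in> Y \<Longrightarrow> polynomial_on U c (h y)) \<Longrightarrow> polynomial_on U c (\<lambda>x. \<Prod>y\<in>Y. h y x)"
  by (induction Y rule: infinite_finite_induct)
    (auto simp: polynomial_on_const polynomial_on_mult)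

lemma polynomial_on_det:
  assumes "\<And>i k. i < n \<Longrightarrow> k < n \<Longrightarrow> polynomial_on U c (h i k)"
  shows "polynomial_on U c (\<lambda>x. det (Matrix.mat n n (\<lambda>(i, k). h i k x)))"
proof -
  have less: "p i < n" if "p permutes {0..<n}" "i < n" for p i
    using permutes_in_image[OF that(1), of i] that(2) by simp
  have det_eq: "det (Matrix.mat n n (\<lambda>(i, k). h i k x)) =
      (\<Sum>p\<in>{p. p permutes {0..<n}}. signof p * (\<Prod>i = 0..<n. h i (p i) x))" for x
    by (subst det_def'[of _ n]) (auto simp: less intro!: sum.cong prod.cong)
  show ?thesis
    unfolding det_eq
    by (intro polynomial_on_sum polynomial_on_mult polynomial_on_const polynomial_on_prod assms)
      (auto simp: less)
qed

lemma polynomial_on_cong: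
  "polynomial_on U c h \<Longrightarrow> (\<And>x. x \<in> U \<Longrightarrow> h' x = h x) \<Longrightarrow> polynomial_on U c h'"
  unfolding polynomial_on_def by metis

text \<open>The chart coordinates are those of single monomials; the coordinates of a fixed polynomial \<open>f\<close> are
  linear combinations of them, with the coefficients of \<open>f\<close>, which do not depend on the ideal.\<close>

lemma polynomial_on_coord_mod:
  fixes f :: "('i::finite, 'k::field) mpoly"
  assumes "b \<in> B"
  shows "polynomial_on (GT_chart j t B) (GT_coord B) (\<lambda>I. coord_mod I B monomial f b)"
proof (rule polynomial_on_cong)
  show "polynomial_on (GT_chart j t B) (GT_coord B)
      (\<lambda>I. \<Sum>m\<in>Poly_Mapping.keys f. Poly_Mapping.lookup f m * GT_coord B I (m, b))"
    by (intro polynomial_on_sum polynomial_on_mult polynomial_on_const polynomial_on_coordinate)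
next
  fix I :: "('i, 'k) mpoly set" assume "I \<in> GT_chart j t B"
  then have "is_ideal I" "basis_mod I B monomial"
    by (auto simp: GT_chart_def GT_points_def graded_ideal_ideal)
  from coord_mod_linear[OF this assms, of "Poly_Mapping.lookup f" monomial "Poly_Mapping.keys f"]
  show "coord_mod I B monomial f b =
      (\<Sum>m\<in>Poly_Mapping.keys f. Poly_Mapping.lookup f m * GT_coord B I (m, b))"
    by (simp add: sum_scale_monomial GT_coord_def)
qed

lemma points_GT: "points (GT j t) \<subseteq> (\<Union>B\<in>{B. finite B}. GT_chart j t B)"
  by (auto simp: points_def GT_def charted_space_def Let_def principal_open_def)

lemma openin_GT_nonzero:
  assumes "finite B" "polynomial_on (GT_chart j t B) (GT_coord B) h"
  shows "openin (ztop (GT j t)) {I \<in> GT_chart j t B. h I \<noteq> 0}"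
proof -
  obtain g where "\<forall>I\<in>GT_chart j t B. h I = mpeval g (GT_coord B I)"
    using assms(2) by (auto simp: polynomial_on_def)
  then have "{I \<in> GT_chart j t B. h I \<noteq> 0} = principal_open (GT_chart j t B) (GT_coord B) g"
    by (auto simp: principal_open_def)
  also have "openin (ztop (GT j t)) \<dots>"
    unfolding GT_def charted_space_def Let_def
    using assms(1) by (auto intro!: topology_generated_by_Basis)
  finally show ?thesis .
qed

text \<open>A basis of one graded quotient stays linearly independent in all nearby ones: its coordinate
  matrix with respect to the monomial basis of a chart is square, and its determinant is a
  polynomial function on the chart.\<close>

lemma basis_mod_open_independent:
  assumes I: "I \<in> points (GT j t)" and basis: "basis_mod I X e"
  obtains O' where "openin (ztop (GT j t)) O'" "I \<in> O'"
    "\<And>J. J \<in> O' \<Longrightarrow> graded_ideal J \<and> independent_mod J X e"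
proof -
  obtain B where B: "finite B" "I \<in> GT_chart j t B"
    using I points_GT by blast
  have chart: "graded_ideal J" "is_ideal J" "basis_mod J B monomial" if "J \<in> GT_chart j t B" for J
    using that by (auto simp: GT_chart_def GT_points_def graded_ideal_ideal)
  define n where "n = card B"
  obtain b where b: "bij_betw b {0..<n} B"
    using ex_bij_betw_nat_finite[OF B(1)] by (auto simp: n_def)
  have "card X = n"
    using basis_mod_card_eq[OF chart(2)[OF B(2)] basis chart(3)[OF B(2)]] by (simp add: n_def)
  then obtain x where x: "bij_betw x {0..<n} X"
    using ex_bij_betw_nat_finite[OF basis_mod_finite[OF basis]] by auto
  define h where
    "h J = det (Matrix.mat n n (\<lambda>(i, k). coord_mod J B monomial (e (x k)) (b i)))" for J
  have h: "independent_mod J X e \<longleftrightarrow> h J \<noteq> 0" if "J \<in> GT_chart j t B" for J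
    unfolding h_def using chart[OF that] by (intro independent_mod_iff_det_nonzero b x)
  have "polynomial_on (GT_chart j t B) (GT_coord B) h"
    unfolding h_def using b by (intro polynomial_on_det polynomial_on_coord_mod)
      (auto simp: bij_betw_def)
  then have "openin (ztop (GT j t)) {J \<in> GT_chart j t B. h J \<noteq> 0}"
    using B(1) by (rule openin_GT_nonzero[rotated])
  moreover have "h I \<noteq> 0"
    using h[OF B(2)] basis_mod_independent[OF chart(2)[OF B(2)] basis] by simp
  ultimately show ?thesis
    using B(2) h chart(1) by (intro that[of "{J \<in> GT_chart j t B. h J \<noteq> 0}"]) auto
qed

section \<open>Counting string elements\<close>

text \<open>The indices of the string elements \<open>l ^ b * z u\<close> of degree at most \<open>k\<close> that are visibly multiples
  of \<open>l ^ a\<close>. For the strings of a graded quotient they form a basis of the image of \<open>l ^ a\<close> in its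
  truncation in degree \<open>k\<close>.\<close>

definition string_part :: "nat \<Rightarrow> nat \<Rightarrow> nat \<Rightarrow> (nat \<Rightarrow> nat) \<Rightarrow> (nat \<Rightarrow> nat) \<Rightarrow> (nat \<times> nat) set" where
  "string_part k a s p \<nu> = {(u, b). u < s \<and> a \<le> b \<and> b < p u \<and> \<nu> u + b \<le> k}"

lemma string_part_Sigma:
  "string_part k a s p \<nu> = (SIGMA u:{..<s}. {a..<min (p u) (k + 1 - \<nu> u)})"
  by (auto simp: string_part_def)

lemma finite_string_part: "finite (string_part k a s p \<nu>)"
  by (simp add: string_part_Sigma)

lemma sum_truncated_parts:
  "(\<Sum>q\<in>#image_mset fst (jdt_truncate k (mset (map (\<lambda>u. (p u, \<nu> u)) [0..<s]))). q - a) =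
     card (string_part k a s p \<nu>)"
proof -
  have "(\<Sum>q\<in>#image_mset fst (jdt_truncate k (mset (map (\<lambda>u. (p u, \<nu> u)) [0..<s]))). q - a) =
      (\<Sum>u<s. min (p u) (k + 1 - \<nu> u) - a)"
  proof (induction s)
    case 0
    show ?case by (simp add: jdt_truncate_def)
  next
    case (Suc s)
    then show ?case by (auto simp: jdt_truncate_def)
  qed
  then show ?thesis
    by (simp add: string_part_Sigma)
qed

text \<open>Since \<open>I\<close> is graded, taking the component of degree \<open>d\<close> of an expansion yields an expansion of
  \<open>f\<close> that uses only the basis elements of degree \<open>d\<close>.\<close>

lemma homogeneous_expansion:
  assumes "graded_ideal I" "basis_mod I X e" "\<And>x. x \<in> X \<Longrightarrow> e x \<in> homog (\<delta> x)" "f \<in> homog d"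
  obtains c where "f - (\<Sum>x\<in>X. scale (c x) (e x)) \<in> I" "\<And>x. x \<in> X \<Longrightarrow> \<delta> x \<noteq> d \<Longrightarrow> c x = 0"
proof -
  let ?c = "coord_mod I X e f"
  have "hcomp d (f - (\<Sum>x\<in>X. scale (?c x) (e x))) \<in> I"
    using coord_mod_works(1)[OF assms(2)] assms(1) by (auto simp: graded_ideal_def)
  also have "hcomp d (f - (\<Sum>x\<in>X. scale (?c x) (e x))) =
      f - (\<Sum>x\<in>X. scale (if \<delta> x = d then ?c x else 0) (e x))"
    using hcomp_homog[OF assms(4)] hcomp_homog[OF assms(3)]
    by (auto simp: hcomp_diff hcomp_sum hcomp_scale intro!: sum.cong) (simp add: scale_def)
  finally show ?thesis
    by (rule that) auto
qed

text \<open>The primed strings play the role of the limit algebra, of which only the linear independence in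
  \<open>R/I\<close> survives; the unprimed ones are the strings of \<open>R/I\<close> itself. The elements counted on the
  left are independent and lie in the image of \<open>l ^ a\<close> in degrees at most \<open>k\<close>, and the elements
  counted on the right span this image.\<close>

lemma string_part_card_le:
  fixes l :: "('i, 'k::field) mpoly"
  assumes I: "graded_ideal I" and l: "l \<in> homog 1"
    and z': "\<And>u. u < s' \<Longrightarrow> z' u \<in> homog (\<nu>' u)"
    and indep: "independent_mod I {(u, b). u < s' \<and> b < p' u} (\<lambda>(u, b). l ^ b * z' u)"
    and z: "\<And>u. u < s \<Longrightarrow> z u \<in> homog (\<nu> u) \<and> l ^ p u * z u \<in> I"
    and basis: "basis_mod I {(u, b). u < s \<and> b < p u} (\<lambda>(u, b). l ^ b * z u)"
  shows "card (string_part k a s' p' \<nu>') \<le> card (string_part k a s p \<nu>)"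
proof -
  let ?e' = "\<lambda>(u, b). l ^ b * z' u" and ?e = "\<lambda>(u, b). l ^ b * z u"
  let ?X = "{(u, b). u < s \<and> b < p u}" and ?Y = "string_part k a s p \<nu>"
  have ideal: "is_ideal I"
    using I by (rule graded_ideal_ideal)
  have homog: "l ^ b * y \<in> homog (b + d)" if "y \<in> homog d" for b d and y
    using homog_mult[OF homog_power[OF l, of b] that] by simp
  have fin_X: "finite ?X"
    using basis by (rule basis_mod_finite)
  show ?thesis
  proof (rule independent_mod_card_le[OF ideal])
    have "{(u, b). u < s' \<and> b < p' u} = (SIGMA u:{..<s'}. {..<p' u})"
      by auto
    then have "finite {(u, b). u < s' \<and> b < p' u}"
      by simp
    then show "independent_mod I (string_part k a s' p' \<nu>') ?e'"
      by (rule independent_mod_subset[OF indep]) (auto simp: string_part_def)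
  next
    fix x assume "x \<in> string_part k a s' p' \<nu>'"
    then obtain v b where x: "x = (v, b)" and v: "v < s'" "a \<le> b" "b < p' v" "\<nu>' v + b \<le> k"
      by (auto simp: string_part_def)
    let ?f = "l ^ (b - a) * z' v" and ?d = "b - a + \<nu>' v"
    have "?f \<in> homog ?d"
      using homog z' v by blast
    moreover have "?e y \<in> homog (snd y + \<nu> (fst y))" if "y \<in> ?X" for y
      using that homog z by auto
    ultimately obtain c where c: "?f - (\<Sum>y\<in>?X. scale (c y) (?e y)) \<in> I"
      "\<And>y. y \<in> ?X \<Longrightarrow> snd y + \<nu> (fst y) \<noteq> ?d \<Longrightarrow> c y = 0"
      using homogeneous_expansion[OF I basis, of "\<lambda>y. snd y + \<nu> (fst y)" ?f ?d] by auto
    \<comment> \<open>Multiplication by \<open>l ^ a\<close> moves the string element \<open>(u, d)\<close> to \<open>(u, d + a)\<close>, which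
      vanishes in the quotient if it runs off the end of the string.\<close>
    let ?X1 = "{(u, d). u < s \<and> d + a < p u \<and> d + \<nu> u = ?d}"
    let ?\<sigma> = "\<lambda>(u, d). (u, d + a)"
    have vanish: "scale (c y) (?e (?\<sigma> y)) \<in> I" if "y \<in> ?X - ?X1" for y
    proof -
      obtain u d where y: "y = (u, d)"
        by (cases y)
      show ?thesis
      proof (cases "d + \<nu> u = ?d")
        case False
        then have "c y = 0"
          using c(2)[of y] that y by auto
        then show ?thesis
          by (simp add: ideal_0 ideal)
      next
        case True
        then have "u < s" "p u \<le> d + a"
          using that y by auto
        then have "l ^ (d + a) * z u = l ^ (d + a - p u) * (l ^ p u * z u)"
          by (simp add: mult.assoc[symmetric] flip: power_add)
        then show ?thesis
          using z \<open>u < s\<close> y by (simp add: ideal_scale ideal ideal_mult)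
      qed
    qed
    have X1: "?X1 \<subseteq> ?X" "inj_on ?\<sigma> ?X1" "?\<sigma> ` ?X1 \<subseteq> ?Y"
      using v by (auto simp: string_part_def inj_on_def)
    define g where "g y = (if y \<in> ?\<sigma> ` ?X1 then c (fst y, snd y - a) else 0)" for y
    have "(\<Sum>y\<in>?Y. scale (g y) (?e y)) = (\<Sum>y\<in>?\<sigma> ` ?X1. scale (g y) (?e y))"
      using X1 by (intro sum.mono_neutral_right finite_string_part) (auto simp: g_def)
    also have "\<dots> = (\<Sum>y\<in>?X1. scale (c y) (?e (?\<sigma> y)))"
      unfolding sum.reindex[OF X1(2)] by (rule sum.cong) (auto simp: g_def)
    finally have sum_Y: "(\<Sum>y\<in>?X1. scale (c y) (?e (?\<sigma> y))) = (\<Sum>y\<in>?Y. scale (g y) (?e y))"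
      by simp
    have shift: "l ^ a * ?e y = ?e (?\<sigma> y)" for y
      by (cases y) (simp add: power_add ac_simps)
    have "l ^ a * (\<Sum>y\<in>?X. scale (c y) (?e y)) = (\<Sum>y\<in>?X. scale (c y) (?e (?\<sigma> y)))"
      by (simp only: sum_distrib_left scale_mult_right shift)
    also have "\<dots> = (\<Sum>y\<in>?X - ?X1. scale (c y) (?e (?\<sigma> y))) +
        (\<Sum>y\<in>?X1. scale (c y) (?e (?\<sigma> y)))"
      by (rule sum.subset_diff[OF X1(1) fin_X])
    finally have split: "l ^ a * (\<Sum>y\<in>?X. scale (c y) (?e y)) =
        (\<Sum>y\<in>?X - ?X1. scale (c y) (?e (?\<sigma> y))) + (\<Sum>y\<in>?Y. scale (g y) (?e y))"
      unfolding sum_Y .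
    have "?e' x = l ^ a * ?f"
      using v x by (simp add: mult.assoc[symmetric] flip: power_add)
    then have "?e' x - (\<Sum>y\<in>?Y. scale (g y) (?e y)) =
        l ^ a * (?f - (\<Sum>y\<in>?X. scale (c y) (?e y))) + (\<Sum>y\<in>?X - ?X1. scale (c y) (?e (?\<sigma> y)))"
      by (simp only: right_diff_distrib split) (simp only: algebra_simps)
    also have "\<dots> \<in> I"
      using c(1) vanish by (intro ideal_add ideal_mult ideal_sum ideal)
    finally show "\<exists>g. ?e' x - (\<Sum>y\<in>?Y. scale (g y) (?e y)) \<in> I"
      by (intro exI[of _ g])
  qed (rule finite_string_part)+
qed

section \<open>Dominance\<close>

lemma sum_take_le:
  fixes xs :: "nat list"
  shows "sum_list (take i xs) \<le> i * a + (\<Sum>x\<leftarrow>xs. x - a)"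
proof (induction xs arbitrary: i)
  case (Cons x xs)
  show ?case
  proof (cases i)
    case (Suc i')
    then show ?thesis using Cons[of i'] by simp
  qed simp
qed simp

text \<open>In a descending list the bound of \<open>sum_take_le\<close> is attained where \<open>a\<close> is the first part that is
  not taken: the parts taken are at least \<open>a\<close>, the others at most \<open>a\<close>. If all parts are taken,
  \<open>a = 0\<close> works.\<close>

lemma sum_take_eq:
  fixes xs :: "nat list"
  assumes "sorted_wrt (\<ge>) xs"
  shows "\<exists>a. sum_list (take i xs) = i * a + (\<Sum>x\<leftarrow>xs. x - a)"
proof (cases "i < length xs")
  case True
  let ?a = "xs ! i"
  have desc: "xs ! n \<le> xs ! m" if "m \<le> n" "n < length xs" for m n
    using sorted_wrt_nth_less[OF assms, of m n] that by (cases "m = n") simp_all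
  have low: "x - ?a = 0" if "x \<in> set (drop i xs)" for x
  proof -
    obtain n where "n < length (drop i xs)" "x = drop i xs ! n"
      using \<open>x \<in> set (drop i xs)\<close> by (metis in_set_conv_nth)
    then show ?thesis
      using desc[of i "i + n"] by simp
  qed
  have "?a \<le> x" if "x \<in> set (take i xs)" for x
  proof -
    obtain n where "n < length (take i xs)" "x = take i xs ! n"
      using \<open>x \<in> set (take i xs)\<close> by (metis in_set_conv_nth)
    then show ?thesis
      using desc[of n i] True by simp
  qed
  then have "(\<Sum>x\<leftarrow>take i xs. x) = (\<Sum>x\<leftarrow>take i xs. ?a + (x - ?a))"
    by (intro arg_cong[of _ _ sum_list] map_cong) auto
  also have "\<dots> = i * ?a + (\<Sum>x\<leftarrow>take i xs. x - ?a)"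
    using True by (simp add: sum_list_addf sum_list_triv)
  also have "(\<Sum>x\<leftarrow>take i xs. x - ?a) = (\<Sum>x\<leftarrow>take i xs. x - ?a) + (\<Sum>x\<leftarrow>drop i xs. x - ?a)"
    using low by simp
  also have "\<dots> = (\<Sum>x\<leftarrow>take i xs @ drop i xs. x - ?a)"
    by (simp only: map_append sum_list_append)
  finally show ?thesis
    by (intro exI[of _ ?a]) simp
next
  case False
  then show ?thesis
    by (intro exI[of _ 0]) simp
qed

lemma dominance_leI:
  assumes "\<And>a. (\<Sum>q\<in>#P. q - a) \<le> (\<Sum>q\<in>#Q. q - a)"
  shows "dominance_le P Q"
  unfolding dominance_le_def
proof
  fix i
  have parts: "(\<Sum>q\<leftarrow>parts_desc R. q - a) = (\<Sum>q\<in>#R. q - a)" for R a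
  proof -
    have "mset (map (\<lambda>q. q - a) (parts_desc R)) = image_mset (\<lambda>q. q - a) R"
      by (simp add: parts_desc_def)
    then show ?thesis
      by (metis sum_mset_sum_list)
  qed
  have "sorted_wrt (\<ge>) (parts_desc Q)"
    by (simp add: parts_desc_def sorted_wrt_rev)
  then obtain a where a: "sum_list (take i (parts_desc Q)) = i * a + (\<Sum>q\<leftarrow>parts_desc Q. q - a)"
    using sum_take_eq by blast
  have "sum_list (take i (parts_desc P)) \<le> i * a + (\<Sum>q\<leftarrow>parts_desc P. q - a)"
    by (rule sum_take_le)
  also have "\<dots> \<le> i * a + (\<Sum>q\<leftarrow>parts_desc Q. q - a)"
    using assms by (simp add: parts)
  finally show "sum_list (take i (parts_desc P)) \<le> sum_list (take i (parts_desc Q))"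
    by (simp add: a)
qed

theorem lemma2p29:
  fixes W :: "('w, 'k::field) fspace"
    and A :: "'w \<Rightarrow> ('r::finite, 'k) mpoly set"
    and l :: "('r, 'k) mpoly"
    and w0 :: 'w
    and j :: nat and t :: "nat \<Rightarrow> nat"
    and P :: "nat multiset"
    and S S0 :: "(nat \<times> nat) multiset"
  assumes "infinite (UNIV :: 'k set)"
    and "l \<in> homog 1"
    and "variety W"
    and "w0 \<in> points W"
    and "w0 \<in> (ztop W) closure_of (points W - {w0})"
    and "morphism W (GT j t) A"
    and "\<And>w. w \<in> points W \<Longrightarrow> w \<noteq> w0 \<Longrightarrow> is_jordan_type (A w) l P"
    and "\<And>w. w \<in> points W \<Longrightarrow> w \<noteq> w0 \<Longrightarrow> is_jordan_degree_type (A w) l S"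
    and "is_jordan_type (A w0) l P"
    and "is_jordan_degree_type (A w0) l S0"
  shows "jdt_ge S S0"
proof -
  obtain s0 z0 p0 \<nu>0 where z0: "\<And>u. u < s0 \<Longrightarrow> z0 u \<in> homog (\<nu>0 u)"
    and basis0: "basis_mod (A w0) {(u, b). u < s0 \<and> b < p0 u} (\<lambda>(u, b). l ^ b * z0 u)"
    and S0: "S0 = mset (map (\<lambda>u. (p0 u, \<nu>0 u)) [0..<s0])"
    using assms(10) unfolding is_jordan_degree_type_def
    by (elim exE conjE) (rule that[rotated], assumption, assumption, blast)
  have cont: "continuous_map (ztop W) (ztop (GT j t)) A"
    using assms(6) by (simp add: morphism_def)
  have "A w0 \<in> points (GT j t)"
    using continuous_map_image_subset_topspace[OF cont] assms(4) by (auto simp: points_def)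
  then obtain O' where O': "openin (ztop (GT j t)) O'" "A w0 \<in> O'"
    and indep: "\<And>J. J \<in> O' \<Longrightarrow> graded_ideal J \<and>
      independent_mod J {(u, b). u < s0 \<and> b < p0 u} (\<lambda>(u, b). l ^ b * z0 u)"
    by (rule basis_mod_open_independent[OF _ basis0]) auto
  have "openin (ztop W) {w \<in> points W. A w \<in> O'}"
    using openin_continuous_map_preimage[OF cont O'(1)] by (simp add: points_def)
  then obtain w where w: "w \<in> points W" "w \<noteq> w0" "A w \<in> O'"
    using assms(4,5) O'(2) by (auto simp: in_closure_of dest!: spec[of _ "{w \<in> points W. A w \<in> O'}"])
  obtain s z p \<nu> where z: "\<And>u. u < s \<Longrightarrow> z u \<in> homog (\<nu> u) \<and> l ^ p u * z u \<in> A w"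
    and basis: "basis_mod (A w) {(u, b). u < s \<and> b < p u} (\<lambda>(u, b). l ^ b * z u)"
    and S: "S = mset (map (\<lambda>u. (p u, \<nu> u)) [0..<s])"
    using assms(8)[OF w(1,2)] unfolding is_jordan_degree_type_def
    by (elim exE conjE) (rule that[rotated], assumption, assumption, blast)
  have "card (string_part k a s0 p0 \<nu>0) \<le> card (string_part k a s p \<nu>)" for k a
  proof (rule string_part_card_le[OF _ assms(2) z0 _ z basis])
    show "graded_ideal (A w)"
      and "independent_mod (A w) {(u, b). u < s0 \<and> b < p0 u} (\<lambda>(u, b). l ^ b * z0 u)"
      using indep[OF w(3)] by (rule conjunct1, rule conjunct2)
  qed
  then show ?thesis
    unfolding jdt_ge_def S S0 by (intro allI dominance_leI) (simp only: sum_truncated_parts)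
qed

end
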